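(* Let $n \geq 3$ and let $S = S^1_{n^2}$ be the sunlet on $2n^2$ vertices. Then there is a homomorphism $\varphi: S \to C_n \,\Box\, C_n$ which is a covering and is 2-to-1 on vertices, such that $\varphi(Z(S))$ is a Hamiltonian cycle of $C_n \,\Box\, C_n$. Furthermore, $\varphi$ is compatible with the FSM orientation of $S$ and the standard orientation of $C_n \,\Box\, C_n$.
   Context: For $p \geq 3$, the sunlet $S^1_p$ is the graph obtained from a cycle $C_p$ by attaching one pendant edge at each vertex of the cycle (so it has $2p$ vertices: $p$ cycle vertices of degree 3 and $p$ vertices of degree 1, and $2p$ edges). $Z(S)$ denotes the unique cycle of a sunlet $S$. $C_n \,\Box\, C_n$ is the Cartesian product of two $n$-cycles (toroidal grid), with vertex set $\mathbb{Z}_n \times \mathbb{Z}_n$, where $(x,y)$ is adjacent to $(x\pm1,y)$ and $(x,y\pm1)$. A homomorphism $\varphi: G \to H$ is a map $V(G)\to V(H)$ sending edges $uw$ to edges $\varphi(u)\varphi(w)$; it is a covering if the induced map $E(G) \to E(H)$ is a bijection; it is 2-to-1 on vertices if every vertex of $H$ has exactly two preimages. The FSM orientation of a sunlet orients its cycle as a directed cycle and orients each pendant edge from its degree-1 vertex toward the cycle vertex (so every vertex has out-degree 1). The standard orientation of $C_n \,\Box\, C_n$ directs every edge in the direction of increasing coordinate, i.e. $(x,y) \to (x+1,y)$ and $(x,y) \to (x,y+1)$ (indices mod $n$). Given orientations of $G$ and $H$, $\varphi$ is compatible with them if $(\varphi(u),\varphi(w))$ is an arc of $H$ whenever $(u,w)$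 is an arc of $G$. *)

theory Defs
  imports Main "HOL-Library.FuncSet"
begin

record 'a graph =
  verts :: "'a set"
  edges :: "'a set set"

definition simple_graph :: "'a graph \<Rightarrow> bool" where
  "simple_graph G \<longleftrightarrow> finite (verts G) \<and>
     (\<forall>e \<in> edges G. \<exists>u \<in> verts G. \<exists>w \<in> verts G. u \<noteq> w \<and> e = {u, w})"

definition subgraph :: "'a graph \<Rightarrow> 'a graph \<Rightarrow> bool" where
  "subgraph H G \<longleftrightarrow> verts H \<subseteq> verts G \<and> edges H \<subseteq> edges G"

definition map_graph :: "('a \<Rightarrow> 'b) \<Rightarrow> 'a graph \<Rightarrow> 'b graph" where
  "map_graph f G = \<lparr>verts = f ` verts G, edges = (`) f ` edges G\<rparr>"

definition homomorphism :: "('a \<Rightarrow> 'b) \<Rightarrow> 'a graph \<Rightarrow> 'b graph \<Rightarrow> bool" where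
  "homomorphism f G H \<longleftrightarrow> f \<in> verts G \<rightarrow> verts H \<and>
     (\<forall>u w. {u, w} \<in> edges G \<longrightarrow> {f u, f w} \<in> edges H)"

(* Edge-bijective homomorphism; this is not a covering map in the local-isomorphism sense. *)
definition covering :: "('a \<Rightarrow> 'b) \<Rightarrow> 'a graph \<Rightarrow> 'b graph \<Rightarrow> bool" where
  "covering f G H \<longleftrightarrow> homomorphism f G H \<and> bij_betw ((`) f) (edges G) (edges H)"

definition two_to_one :: "('a \<Rightarrow> 'b) \<Rightarrow> 'a graph \<Rightarrow> 'b graph \<Rightarrow> bool" where
  "two_to_one f G H \<longleftrightarrow> (\<forall>y \<in> verts H. card {x \<in> verts G. f x = y} = 2)"

(* An orientation of a graph is represented by its set of arcs. *)
definition orientation :: "'a graph \<Rightarrow> ('a \<times> 'a) set \<Rightarrow> bool" where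
  "orientation G A \<longleftrightarrow> (\<forall>(u, w) \<in> A. {u, w} \<in> edges G) \<and>
     (\<forall>u w. {u, w} \<in> edges G \<longrightarrow> ((u, w) \<in> A) \<noteq> ((w, u) \<in> A))"

definition compatible :: "('a \<Rightarrow> 'b) \<Rightarrow> ('a \<times> 'a) set \<Rightarrow> ('b \<times> 'b) set \<Rightarrow> bool" where
  "compatible f A B \<longleftrightarrow> (\<forall>(u, w) \<in> A. (f u, f w) \<in> B)"

(* For n < 3 the edge set degenerates; all uses have n at least 3. *)
definition cycle_graph :: "nat \<Rightarrow> nat graph" where
  "cycle_graph n = \<lparr>verts = {..<n}, edges = {{i, Suc i mod n} | i. i < n}\<rparr>"

definition is_cycle :: "'a graph \<Rightarrow> bool" where
  "is_cycle C \<longleftrightarrow> (\<exists>k f. 3 \<le> k \<and> inj_on f {..<k} \<and> C = map_graph f (cycle_graph k))"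

definition hamiltonian_cycle :: "'a graph \<Rightarrow> 'a graph \<Rightarrow> bool" where
  "hamiltonian_cycle G C \<longleftrightarrow> is_cycle C \<and> subgraph C G \<and> verts C = verts G"

definition cartesian_product :: "'a graph \<Rightarrow> 'b graph \<Rightarrow> ('a \<times> 'b) graph" where
  "cartesian_product G H = \<lparr>verts = verts G \<times> verts H,
     edges = {{(x, y), (x', y)} | x x' y. {x, x'} \<in> edges G \<and> y \<in> verts H}
           \<union> {{(x, y), (x, y')} | x y y'. x \<in> verts G \<and> {y, y'} \<in> edges H}\<rparr>"

definition torus :: "nat \<Rightarrow> (nat \<times> nat) graph" where
  "torus n = cartesian_product (cycle_graph n) (cycle_graph n)"

definition standard_orientation :: "nat \<Rightarrow> ((nat \<times> nat) \<times> (nat \<times> nat)) set" where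
  "standard_orientation n =
     {((x, y), (Suc x mod n, y)) | x y. x < n \<and> y < n}
   \<union> {((x, y), (x, Suc y mod n)) | x y. x < n \<and> y < n}"

datatype sunlet_vertex = Rim nat | Leaf nat

definition sunlet_cycle :: "nat \<Rightarrow> sunlet_vertex graph" where
  "sunlet_cycle p = map_graph Rim (cycle_graph p)"

definition sunlet :: "nat \<Rightarrow> sunlet_vertex graph" where
  "sunlet p = \<lparr>verts = verts (sunlet_cycle p) \<union> Leaf ` {..<p},
     edges = edges (sunlet_cycle p) \<union> {{Leaf i, Rim i} | i. i < p}\<rparr>"

(* The direction chosen for the cycle is immaterial: reflecting the sunlet reverses it. *)
definition FSM_orientation :: "nat \<Rightarrow> (sunlet_vertex \<times> sunlet_vertex) set" where
  "FSM_orientation p =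
     {(Rim i, Rim (Suc i mod p)) | i. i < p} \<union> {(Leaf i, Rim i) | i. i < p}"

lemma Suc_mod_cases: "i < n \<Longrightarrow> Suc i mod n = (if Suc i = n then 0 else Suc i)" for i n :: nat
  by auto

lemma edge_cycle_graph_iff:
  "{u, w} \<in> edges (cycle_graph n) \<longleftrightarrow> (u < n \<and> w = Suc u mod n) \<or> (w < n \<and> u = Suc w mod n)"
  by (auto simp: cycle_graph_def doubleton_eq_iff)

lemma edge_cartesian_product_iff:
  "{(x, y), (x', y')} \<in> edges (cartesian_product G H) \<longleftrightarrow>
     (y = y' \<and> y \<in> verts H \<and> {x, x'} \<in> edges G) \<or> (x = x' \<and> x \<in> verts G \<and> {y, y'} \<in> edges H)"
proof -
  have "{(x, y), (x', y')} \<in> edges (cartesian_product G H) \<longleftrightarrow>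
     (\<exists>a a' b. {(x, y), (x', y')} = {(a, b), (a', b)} \<and> {a, a'} \<in> edges G \<and> b \<in> verts H) \<or>
     (\<exists>a b b'. {(x, y), (x', y')} = {(a, b), (a, b')} \<and> a \<in> verts G \<and> {b, b'} \<in> edges H)"
    by (simp add: cartesian_product_def)
  also have "\<dots> \<longleftrightarrow> (y = y' \<and> y \<in> verts H \<and> {x, x'} \<in> edges G) \<or>
     (x = x' \<and> x \<in> verts G \<and> {y, y'} \<in> edges H)"
    (is "?A \<or> ?B \<longleftrightarrow> ?A' \<or> ?B'")
  proof -
    have "?A \<longleftrightarrow> ?A'" by (auto simp: doubleton_eq_iff insert_commute)
    moreover have "?B \<longleftrightarrow> ?B'" by (auto simp: doubleton_eq_iff insert_commute)
    ultimately show ?thesis by blast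
  qed
  finally show ?thesis .
qed

lemma standard_orientation_iff:
  "((x, y), (x', y')) \<in> standard_orientation n \<longleftrightarrow>
     x < n \<and> y < n \<and> (x' = Suc x mod n \<and> y' = y \<or> x' = x \<and> y' = Suc y mod n)"
  unfolding standard_orientation_def by blast

lemma edge_torus_iff:
  "{u, w} \<in> edges (torus n) \<longleftrightarrow>
     (u, w) \<in> standard_orientation n \<or> (w, u) \<in> standard_orientation n"
proof -
  obtain x y x' y' where uw: "u = (x, y)" "w = (x', y')" by (metis surj_pair)
  have "verts (cycle_graph n) = {..<n}" by (simp add: cycle_graph_def)
  then show ?thesis
    unfolding torus_def uw edge_cartesian_product_iff edge_cycle_graph_iff standard_orientation_iff
      lessThan_iff by (metis lessThan_iff)
qed

lemma map_cycle_graph_simps: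
  "verts (map_graph f (cycle_graph n)) = f ` {..<n}"
  "edges (map_graph f (cycle_graph n)) = {{f i, f (Suc i mod n)} | i. i < n}"
proof -
  have "edges (map_graph f (cycle_graph n)) = (\<lambda>i. {f i, f (Suc i mod n)}) ` {i. i < n}"
    unfolding map_graph_def cycle_graph_def by (simp add: setcompr_eq_image image_image)
  then show "edges (map_graph f (cycle_graph n)) = {{f i, f (Suc i mod n)} | i. i < n}"
    by (simp add: setcompr_eq_image)
qed (simp add: map_graph_def cycle_graph_def)

lemmas sunlet_cycle_simps = map_cycle_graph_simps[of Rim, folded sunlet_cycle_def]

lemma edge_sunlet_iff:
  "{u, w} \<in> edges (sunlet p) \<longleftrightarrow>
     (u, w) \<in> FSM_orientation p \<or> (w, u) \<in> FSM_orientation p"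
proof -
  have "{u, w} \<in> edges (sunlet p) \<longleftrightarrow>
      (\<exists>i<p. {u, w} = {Rim i, Rim (Suc i mod p)}) \<or> (\<exists>i<p. {u, w} = {Leaf i, Rim i})"
    by (auto simp: sunlet_def sunlet_cycle_simps)
  then show ?thesis
    unfolding FSM_orientation_def doubleton_eq_iff by blast
qed

lemma Suc_mod_asym: "3 \<le> n \<Longrightarrow> i < n \<Longrightarrow> i \<noteq> Suc (Suc i mod n) mod n" for i n :: nat
  by (cases "Suc i = n"; cases "Suc (Suc i) = n") auto

lemma Suc_mod_neq: "3 \<le> n \<Longrightarrow> i < n \<Longrightarrow> i \<noteq> Suc i mod n" for i n :: nat
  by (cases "Suc i = n") auto

lemma orientation_FSM:
  assumes "3 \<le> p" shows "orientation (sunlet p) (FSM_orientation p)"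
proof -
  have "(w, u) \<notin> FSM_orientation p" if "(u, w) \<in> FSM_orientation p" for u w
    using that Suc_mod_asym[OF assms] unfolding FSM_orientation_def by blast
  then show ?thesis
    unfolding orientation_def edge_sunlet_iff by blast
qed

lemma orientation_standard:
  assumes "3 \<le> n" shows "orientation (torus n) (standard_orientation n)"
proof -
  have "(w, u) \<notin> standard_orientation n" if "(u, w) \<in> standard_orientation n" for u w
    using that Suc_mod_asym[OF assms] Suc_mod_neq[OF assms]
    by (cases u; cases w) (metis standard_orientation_iff)
  then show ?thesis
    unfolding orientation_def edge_torus_iff by blast
qed

lemma simple_graph_cycle_graph: "3 \<le> n \<Longrightarrow> simple_graph (cycle_graph n)"
  unfolding simple_graph_def
proof (intro conjI ballI)
  fix e assume n: "3 \<le> n" and "e \<in> edges (cycle_graph n)"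
  then obtain i where i: "i < n" "e = {i, Suc i mod n}" by (auto simp: cycle_graph_def)
  then have "Suc i mod n < n" "i \<noteq> Suc i mod n" using Suc_mod_neq[OF n i(1)] by auto
  then show "\<exists>u \<in> verts (cycle_graph n). \<exists>w \<in> verts (cycle_graph n). u \<noteq> w \<and> e = {u, w}"
    using i(1)
    by (intro bexI[of _ i] bexI[of _ "Suc i mod n"] conjI i(2)) (simp_all add: cycle_graph_def)
qed (simp add: cycle_graph_def)

lemma simple_graph_torus:
  assumes "3 \<le> n" shows "simple_graph (torus n)"
  unfolding simple_graph_def
proof (intro conjI ballI)
  show "finite (verts (torus n))"
    by (simp add: torus_def cartesian_product_def cycle_graph_def)
next
  have *: "x \<in> verts (cycle_graph n)" "x' \<in> verts (cycle_graph n)" "x \<noteq> x'"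
    if "{x, x'} \<in> edges (cycle_graph n)" for x x'
  proof -
    have "x < n \<and> x' < n \<and> x \<noteq> x'"
      using that assms Suc_mod_neq unfolding edge_cycle_graph_iff
      by (metis mod_less_divisor not_less0 not_gr_zero)
    then show "x \<in> verts (cycle_graph n)" "x' \<in> verts (cycle_graph n)" "x \<noteq> x'"
      by (simp_all add: cycle_graph_def)
  qed
  fix e assume "e \<in> edges (torus n)"
  then consider
      x x' y where "e = {(x, y), (x', y)}" "{x, x'} \<in> edges (cycle_graph n)" "y \<in> verts (cycle_graph n)"
    | x y y' where "e = {(x, y), (x, y')}" "x \<in> verts (cycle_graph n)" "{y, y'} \<in> edges (cycle_graph n)"
    unfolding torus_def cartesian_product_def by auto
  then show "\<exists>u \<in> verts (torus n). \<exists>w \<in> verts (torus n). u \<noteq> w \<and> e = {u, w}"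
  proof cases
    case 1
    then show ?thesis using *[OF 1(2)]
      by (intro bexI[of _ "(x, y)"] bexI[of _ "(x', y)"]) (auto simp: torus_def cartesian_product_def)
  next
    case 2
    then show ?thesis using *[OF 2(3)]
      by (intro bexI[of _ "(x, y)"] bexI[of _ "(x, y')"]) (auto simp: torus_def cartesian_product_def)
  qed
qed

lemma simple_graph_sunlet:
  assumes "3 \<le> p" shows "simple_graph (sunlet p)"
  unfolding simple_graph_def
proof (intro conjI ballI)
  show "finite (verts (sunlet p))"
    by (simp add: sunlet_def sunlet_cycle_simps)
next
  fix e assume "e \<in> edges (sunlet p)"
  then consider i where "i < p" "e = {Rim i, Rim (Suc i mod p)}" | i where "i < p" "e = {Leaf i, Rim i}"
    by (auto simp: sunlet_def sunlet_cycle_simps)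
  then show "\<exists>u \<in> verts (sunlet p). \<exists>w \<in> verts (sunlet p). u \<noteq> w \<and> e = {u, w}"
  proof cases
    case 1
    then have "Suc i mod p < p" "i \<noteq> Suc i mod p" using Suc_mod_neq[OF assms] by auto
    then show ?thesis using 1
      by (intro bexI[of _ "Rim i"] bexI[of _ "Rim (Suc i mod p)"])
        (auto simp: sunlet_def sunlet_cycle_simps)
  next
    case 2
    then show ?thesis
      by (intro bexI[of _ "Leaf i"] bexI[of _ "Rim i"])
        (auto simp: sunlet_def sunlet_cycle_simps)
  qed
qed

lemma is_cycle_two_neighbours:
  assumes "is_cycle C" "v \<in> verts C"
  obtains a b where "a \<noteq> b" "{v, a} \<in> edges C" "{v, b} \<in> edges C"
proof -
  obtain k f where k: "3 \<le> k" "inj_on f {..<k}" "C = map_graph f (cycle_graph k)"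
    using assms(1) by (auto simp: is_cycle_def)
  obtain i where i: "i < k" "v = f i"
    using assms(2) k(3) by (auto simp: map_cycle_graph_simps)
  have edge: "{f j, f (Suc j mod k)} \<in> edges C" if "j < k" for j
    using that k(3) by (auto simp: map_cycle_graph_simps)
  define j where "j = (if i = 0 then k - 1 else i - 1)"
  have j: "j < k" "Suc j mod k = i" "j \<noteq> Suc i mod k" "Suc i mod k < k"
    using i k(1) by (auto simp: j_def Suc_mod_cases)
  have "f j \<noteq> f (Suc i mod k)"
    using j k(2) by (auto dest: inj_onD)
  moreover have "{v, f j} \<in> edges C" using edge[OF j(1)] j(2) i(2) by (simp add: insert_commute)
  moreover have "{v, f (Suc i mod k)} \<in> edges C" using edge[OF i(1)] i(2) by simp
  ultimately show ?thesis by (rule that)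
qed

(* The sunlet has exactly one cycle, so sunlet_cycle is the subgraph Z(S). *)
lemma sunlet_cycle_unique:
  assumes "3 \<le> p"
  shows "is_cycle C \<and> subgraph C (sunlet p) \<longleftrightarrow> C = sunlet_cycle p"
proof
  assume "C = sunlet_cycle p"
  moreover have "is_cycle (sunlet_cycle p)"
    unfolding is_cycle_def sunlet_cycle_def
    by (intro exI[of _ p] exI[of _ Rim]) (simp add: assms inj_on_def)
  ultimately show "is_cycle C \<and> subgraph C (sunlet p)"
    by (auto simp: subgraph_def sunlet_def)
next
  assume C: "is_cycle C \<and> subgraph C (sunlet p)"
  then have sub: "e \<in> edges (sunlet p)" if "e \<in> edges C" for e
    using that by (auto simp: subgraph_def)
  have ends: "u \<in> verts C" "w \<in> verts C" if e: "{u, w} \<in> edges C" for u w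
  proof -
    obtain k f where k: "3 \<le> k" "C = map_graph f (cycle_graph k)"
      using C by (auto simp: is_cycle_def)
    then obtain i where "i < k" "{u, w} = {f i, f (Suc i mod k)}"
      using e by (auto simp: map_cycle_graph_simps)
    moreover from this have "Suc i mod k < k" by simp
    ultimately show "u \<in> verts C" "w \<in> verts C"
      using k(2) by (auto simp: map_cycle_graph_simps doubleton_eq_iff)
  qed
  have no_leaf: "Leaf i \<notin> verts C" for i
  proof
    assume v: "Leaf i \<in> verts C"
    obtain a b where "a \<noteq> b" "{Leaf i, a} \<in> edges C" "{Leaf i, b} \<in> edges C"
      by (rule is_cycle_two_neighbours[OF conjunct1[OF C] v])
    then show False
      using sub[of "{Leaf i, a}"] sub[of "{Leaf i, b}"] by (simp add: edge_sunlet_iff FSM_orientation_def)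
  qed
  have next_edge: "i < p \<and> {Rim i, Rim (Suc i mod p)} \<in> edges C" if v: "Rim i \<in> verts C" for i
  proof -
    obtain a b where ab: "a \<noteq> b" "{Rim i, a} \<in> edges C" "{Rim i, b} \<in> edges C"
      by (rule is_cycle_two_neighbours[OF conjunct1[OF C] v])
    have nb: "i < p \<and> (c = Rim (Suc i mod p) \<or> (\<exists>j<p. c = Rim j \<and> Suc j mod p = i))"
      if "{Rim i, c} \<in> edges C" for c
    proof -
      have "c \<noteq> Leaf i" using ends(2)[OF that] no_leaf by metis
      then show ?thesis
        using sub[OF that] by (auto simp: edge_sunlet_iff FSM_orientation_def)
    qed
    have inj: "j = j'" if "j < p" "j' < p" "Suc j mod p = Suc j' mod p" for j j'
      using that by (auto simp: Suc_mod_cases split: if_splits)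
    have "a = Rim (Suc i mod p) \<or> b = Rim (Suc i mod p)"
      using nb[OF ab(2)] nb[OF ab(3)] ab(1) inj by metis
    then show ?thesis using ab(2,3) conjunct1[OF nb[OF ab(2)]] by metis
  qed
  have step: "Rim (Suc i mod p) \<in> verts C" if "Rim i \<in> verts C" for i
    by (rule ends(2)[OF conjunct2[OF next_edge[OF that]]])
  obtain i where i: "Rim i \<in> verts C"
  proof -
    obtain k f where k: "3 \<le> k" "C = map_graph f (cycle_graph k)"
      using C by (auto simp: is_cycle_def)
    then have "f 0 \<in> verts C" by (simp add: map_cycle_graph_simps)
    then show ?thesis using that no_leaf by (cases "f 0") auto
  qed
  have "Rim ((i + m) mod p) \<in> verts C" for m
  proof (induction m)
    case 0
    then show ?case using i next_edge[OF i] by simp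
  next
    case (Suc m)
    then show ?case using step[OF Suc] by (simp add: mod_Suc_eq)
  qed
  from this[of "(p - i) + j" for j] have all_rim: "Rim j \<in> verts C" if "j < p" for j
    using that next_edge[OF i] by (metis add.assoc le_add_diff_inverse less_imp_le mod_add_self1 mod_less)
  have V: "verts C = Rim ` {..<p}"
  proof
    show "verts C \<subseteq> Rim ` {..<p}"
    proof
      fix v assume "v \<in> verts C"
      then show "v \<in> Rim ` {..<p}" using no_leaf next_edge by (cases v) auto
    qed
  qed (use all_rim in auto)
  have E: "edges C = edges (sunlet_cycle p)"
  proof
    show "edges (sunlet_cycle p) \<subseteq> edges C"
      using next_edge all_rim by (auto simp: sunlet_cycle_simps)
    show "edges C \<subseteq> edges (sunlet_cycle p)"
    proof
      fix e assume e: "e \<in> edges C"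
      then have "e \<in> edges (sunlet_cycle p) \<or> (\<exists>i. e = {Leaf i, Rim i})"
        using sub[OF e] by (auto simp: sunlet_def)
      then show "e \<in> edges (sunlet_cycle p)" using e ends(1) no_leaf by metis
    qed
  qed
  show "C = sunlet_cycle p"
    using V E by (simp add: sunlet_cycle_simps graph.equality)
qed

end

(* Every vertex of the standard orientation has in-degree and out-degree 2.  Given a directed
   Hamiltonian cycle, wrap the rim of the sunlet around it and send the leaf attached at a rim
   vertex to the in-neighbour of its image that the cycle does not use.  Both arcs entering each
   vertex are then hit exactly once, so arcs correspond bijectively; and since every vertex of the
   FSM orientation has out-degree 1, a vertex has as many preimages as outgoing arcs, namely 2.
   A directed Hamiltonian cycle arises by alternating n - 1 steps in the first coordinate with one
   step in the second. *)

theory Submission imports Defs begin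

text \<open>An orientation contains exactly one of the two directions of every edge, so edges and
  arcs determine each other. The only danger is that two edges with the same image come from arcs
  with opposite images; this cannot happen, since both images lie in \<open>B\<close>, which never
  contains an arc together with its reverse.\<close>

lemma covering_if_bij_arcs:
  assumes G: "simple_graph G" "orientation G A" and H: "simple_graph H" "orientation H B"
    and hom: "f \<in> verts G \<rightarrow> verts H" and bij: "bij_betw (map_prod f f) A B"
  shows "covering f G H"
proof -
  have arcE: "\<exists>u w. e = {u, w} \<and> (u, w) \<in> C" if "simple_graph K" "orientation K C" "e \<in> edges K"
    for K :: "'c graph" and C e
    using that unfolding simple_graph_def orientation_def by (metis insert_commute)
  have edgeI: "{u, w} \<in> edges K" if "orientation K C" "(u, w) \<in> C" for K :: "'c graph" and C u w
    using that unfolding orientation_def by blast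
  have arc: "(f u, f w) \<in> B" if "(u, w) \<in> A" for u w
    using bij_betw_apply[OF bij that] by simp
  have asym: "(w, u) \<notin> B" if "(u, w) \<in> B" for u w
    using that H(2) unfolding orientation_def by blast
  have maps: "f ` e \<in> edges H" if e: "e \<in> edges G" for e
  proof -
    obtain u w where "e = {u, w}" "(u, w) \<in> A" using arcE[OF G e] by blast
    then show ?thesis using edgeI[OF H(2) arc] by simp
  qed
  have "inj_on ((`) f) (edges G)"
  proof (rule inj_onI)
    fix e e' assume e: "e \<in> edges G" "e' \<in> edges G" "f ` e = f ` e'"
    obtain u w where 1: "e = {u, w}" "(u, w) \<in> A" using arcE[OF G e(1)] by blast
    obtain u' w' where 2: "e' = {u', w'}" "(u', w') \<in> A" using arcE[OF G e(2)] by blast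
    have "f u = f u' \<and> f w = f w'"
      using e(3) 1(1) 2(1) arc[OF 1(2)] asym[OF arc[OF 2(2)]] by (auto simp: doubleton_eq_iff)
    then have "(u, w) = (u', w')"
      by (intro inj_onD[OF bij_betw_imp_inj_on[OF bij] _ 1(2) 2(2)]) simp
    then show "e = e'" using 1 2 by simp
  qed
  moreover have "e \<in> (`) f ` edges G" if e: "e \<in> edges H" for e
  proof -
    obtain u w where 1: "e = {u, w}" "(u, w) \<in> B" using arcE[OF H e] by blast
    then have "(u, w) \<in> map_prod f f ` A" using bij_betw_imp_surj_on[OF bij] by simp
    then obtain a b where "(a, b) \<in> A" "u = f a" "w = f b" by auto
    then have "e = f ` {a, b}" "{a, b} \<in> edges G" using 1 edgeI[OF G(2)] by auto
    then show ?thesis by blast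
  qed
  moreover have "{f u, f w} \<in> edges H" if "{u, w} \<in> edges G" for u w
    using maps[OF that] by simp
  ultimately show ?thesis
    using hom maps unfolding covering_def homomorphism_def bij_betw_def by blast
qed

lemma Suc_mod_inj: "i < n \<Longrightarrow> j < n \<Longrightarrow> Suc i mod n = Suc j mod n \<Longrightarrow> i = j" for i j n :: nat
  by (auto simp: Suc_mod_cases split: if_splits)

lemma Suc_mod_surj:
  fixes i n :: nat
  assumes "i < n" obtains j where "j < n" "Suc j mod n = i"
proof (cases i)
  case 0
  then show ?thesis using assms that[of "n - 1"] by simp
next
  case (Suc j)
  then show ?thesis using assms that[of j] by simp
qed

lemma verts_torus: "verts (torus n) = {..<n} \<times> {..<n}"
  by (simp add: torus_def cartesian_product_def cycle_graph_def)

lemma verts_sunlet: "verts (sunlet p) = Rim ` {..<p} \<union> Leaf ` {..<p}"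
  by (simp add: sunlet_def sunlet_cycle_simps)

lemma standard_orientation_verts:
  assumes "(u, w) \<in> standard_orientation n"
  shows "u \<in> verts (torus n)" "w \<in> verts (torus n)"
proof -
  obtain x y x' y' where "u = (x, y)" "w = (x', y')" by (metis surj_pair)
  then show "u \<in> verts (torus n)" "w \<in> verts (torus n)"
    using assms by (auto simp: verts_torus standard_orientation_iff)
qed

lemma standard_orientation_out:
  assumes "3 \<le> n" "u \<in> verts (torus n)"
  shows "card {a \<in> standard_orientation n. fst a = u} = 2"
proof -
  obtain x y where u: "u = (x, y)" "x < n" "y < n" using assms(2) by (auto simp: verts_torus)
  have "{a \<in> standard_orientation n. fst a = u} = {(u, (Suc x mod n, y)), (u, (x, Suc y mod n))}"
    using u by (auto simp: standard_orientation_iff)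
  moreover have "x \<noteq> Suc x mod n" using Suc_mod_neq assms(1) u(2) by blast
  ultimately show ?thesis by simp
qed

text \<open>There is one predecessor in each coordinate direction; they differ because no residue is
  its own successor mod n. In this form, removing the predecessor used by a Hamiltonian cycle leaves
  exactly one in-neighbour for the leaf.\<close>

lemma standard_orientation_in:
  assumes "3 \<le> n" "w \<in> verts (torus n)"
  obtains u v where "u \<noteq> v" "{a. (a, w) \<in> standard_orientation n} = {u, v}"
proof -
  obtain x y where w: "w = (x, y)" "x < n" "y < n" using assms(2) by (auto simp: verts_torus)
  obtain x' where x': "x' < n" "Suc x' mod n = x" using Suc_mod_surj[OF w(2)] .
  obtain y' where y': "y' < n" "Suc y' mod n = y" using Suc_mod_surj[OF w(3)] .
  have "{a. (a, w) \<in> standard_orientation n} = {(x', y), (x, y')}"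
    using w x' y' Suc_mod_inj by (auto simp: standard_orientation_iff)
  moreover have "(x', y) \<noteq> (x, y')" using Suc_mod_neq[OF assms(1) x'(1)] x'(2) by simp
  ultimately show ?thesis using that by blast
qed

text \<open>The argument is free of coordinates: it works from the in- and out-degrees of the torus.
  The length \<open>p\<close> stays a variable, but the bijection \<open>h\<close> forces it to be
  n^2.\<close>

lemma sunlet_cover_if_directed_hamiltonian_cycle:
  assumes n: "3 \<le> n" and p: "3 \<le> p"
    and h: "bij_betw h {..<p} (verts (torus n))"
    and step: "\<And>i. i < p \<Longrightarrow> (h i, h (Suc i mod p)) \<in> standard_orientation n"
  obtains \<phi> where "covering \<phi> (sunlet p) (torus n)" "two_to_one \<phi> (sunlet p) (torus n)"
    "hamiltonian_cycle (torus n) (map_graph \<phi> (sunlet_cycle p))"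
    "compatible \<phi> (FSM_orientation p) (standard_orientation n)"
proof -
  let ?A = "FSM_orientation p" and ?B = "standard_orientation n"
  have hv: "h i \<in> verts (torus n)" if "i < p" for i
    using bij_betw_apply[OF h] that by simp
  have h_inj: "i = j" if "i < p" "j < p" "h i = h j" for i j
    using inj_onD[OF bij_betw_imp_inj_on[OF h]] that by simp
  \<comment> \<open>Here \<open>j\<close> is the rim predecessor of \<open>i\<close>, described by
    its successor so that no subtraction mod p occurs. The vertex \<open>u\<close> is the
    in-neighbour of \<open>h i\<close> whose arc the cycle does not use; it will be the image of
    \<open>Leaf i\<close>.\<close>
  have "\<exists>u. \<forall>j<p. Suc j mod p = i \<longrightarrow> u \<noteq> h j \<and> {a. (a, h i) \<in> ?B} = {h j, u}" if i: "i < p" for i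
  proof -
    obtain j where j: "j < p" "Suc j mod p = i" using Suc_mod_surj[OF i] .
    obtain u v where uv: "u \<noteq> v" "{a. (a, h i) \<in> ?B} = {u, v}"
      using standard_orientation_in[OF n hv[OF i]] .
    have "h j \<in> {u, v}" using step[OF j(1)] j(2) uv(2) by blast
    then have "{a. (a, h i) \<in> ?B} = {h j, if u = h j then v else u}" "(if u = h j then v else u) \<noteq> h j"
      unfolding uv(2) using uv(1) by auto
    then obtain u' where "u' \<noteq> h j" "{a. (a, h i) \<in> ?B} = {h j, u'}" by blast
    moreover have "k = j" if "k < p" "Suc k mod p = i" for k
      by (rule Suc_mod_inj[OF that(1) j(1)]) (simp only: that(2) j(2))
    ultimately show ?thesis by blast
  qed
  then have "\<exists>l. \<forall>i<p. \<forall>j<p. Suc j mod p = i \<longrightarrow> l i \<noteq> h j \<and> {a. (a, h i) \<in> ?B} = {h j, l i}"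
    by (intro choice) blast
  then obtain l where l: "l i \<noteq> h j" "{a. (a, h i) \<in> ?B} = {h j, l i}"
    if "i < p" "j < p" "Suc j mod p = i" for i j by blast
  define \<phi> where "\<phi> = case_sunlet_vertex h l"
  have \<phi>: "\<phi> (Rim i) = h i" "\<phi> (Leaf i) = l i" for i by (simp_all add: \<phi>_def)
  have l_arc: "(l i, h i) \<in> ?B" if i: "i < p" for i
  proof -
    obtain j where j: "j < p" "Suc j mod p = i" using Suc_mod_surj[OF i] .
    then show ?thesis using l(2)[OF i j] by blast
  qed
  have arcs: "map_prod \<phi> \<phi> a \<in> ?B" if "a \<in> ?A" for a
    using that step l_arc by (auto simp: FSM_orientation_def \<phi>)
  have \<phi>v: "\<phi> \<in> verts (sunlet p) \<rightarrow> verts (torus n)"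
    using hv standard_orientation_verts(1)[OF l_arc] by (auto simp: verts_sunlet \<phi>)
  have inj: "inj_on (map_prod \<phi> \<phi>) ?A"
  proof (rule inj_onI)
    \<comment> \<open>An arc is determined by its head \<open>Rim i\<close> and by whether its tail
      is a rim vertex or a leaf. Injectivity of \<open>h\<close> recovers the head from the image,
      and \<open>l i\<close> \<noteq> \<open>h j\<close> recovers the kind of tail.\<close>
    have A: "\<exists>i<p. snd a = Rim i \<and> (\<exists>j<p. Suc j mod p = i \<and> (a = (Rim j, Rim i) \<or> a = (Leaf i, Rim i)))"
      if "a \<in> ?A" for a
      using that unfolding FSM_orientation_def
    proof (elim UnE CollectE exE conjE)
      fix i assume "a = (Leaf i, Rim i)" "i < p"
      then show ?thesis using Suc_mod_surj[of i p] by (metis snd_conv)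
    next
      fix i assume "a = (Rim i, Rim (Suc i mod p))" "i < p"
      then show ?thesis by (intro exI[of _ "Suc i mod p"]) auto
    qed
    fix a b assume ab: "a \<in> ?A" "b \<in> ?A" "map_prod \<phi> \<phi> a = map_prod \<phi> \<phi> b"
    obtain i j where a: "i < p" "j < p" "Suc j mod p = i" "snd a = Rim i"
      "a = (Rim j, Rim i) \<or> a = (Leaf i, Rim i)" using A[OF ab(1)] by blast
    obtain i' j' where b: "i' < p" "j' < p" "Suc j' mod p = i'" "snd b = Rim i'"
      "b = (Rim j', Rim i') \<or> b = (Leaf i', Rim i')" using A[OF ab(2)] by blast
    have "h i = h i'" using ab(3) a(5) b(5) by (auto simp: \<phi>)
    then have i: "i' = i" using h_inj a b by metis
    then have "j' = j" using Suc_mod_inj a b by metis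
    then show "a = b" using i a(5) b(5) ab(3) l(1)[OF a(1-3)] by (auto simp: \<phi>)
  qed
  have surj: "b \<in> map_prod \<phi> \<phi> ` ?A" if "b \<in> ?B" for b
  proof -
    obtain u w where b: "b = (u, w)" by (cases b)
    have "w \<in> verts (torus n)" using standard_orientation_verts(2) that b by blast
    then obtain i where i: "i < p" "w = h i" using bij_betw_imp_surj_on[OF h] by blast
    obtain j where j: "j < p" "Suc j mod p = i" using Suc_mod_surj[OF i(1)] .
    have "u = h j \<or> u = l i" using l(2)[OF i(1) j] that b i(2) by blast
    moreover have "(Rim j, Rim i) \<in> ?A" "(Leaf i, Rim i) \<in> ?A"
      using i(1) j by (auto simp: FSM_orientation_def)
    ultimately show ?thesis using b i(2) by (force simp: \<phi>)
  qed
  have bij: "bij_betw (map_prod \<phi> \<phi>) ?A ?B"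
    by (intro bij_betw_imageI inj equalityI subsetI) (use arcs surj in auto)
  have cov: "covering \<phi> (sunlet p) (torus n)"
    by (rule covering_if_bij_arcs[OF simple_graph_sunlet[OF p] orientation_FSM[OF p]
          simple_graph_torus[OF n] orientation_standard[OF n] \<phi>v bij])
  have "card {x \<in> verts (sunlet p). \<phi> x = y} = 2" if y: "y \<in> verts (torus n)" for y
  proof -
    let ?Ay = "{a \<in> ?A. \<phi> (fst a) = y}"
    \<comment> \<open>Out-degree 1 in the sunlet: \<open>fst\<close> maps arcs bijectively to
      vertices. Counting the preimages of \<open>y\<close> thus becomes counting arcs whose image
      starts at \<open>y\<close>, and the bijection on arcs turns these into the two arcs leaving
      \<open>y\<close>.\<close>
    have "{x \<in> verts (sunlet p). \<phi> x = y} = fst ` ?Ay"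
      by (force simp: verts_sunlet FSM_orientation_def)
    moreover have "inj_on fst ?A" by (auto simp: inj_on_def FSM_orientation_def)
    then have "inj_on fst ?Ay" by (rule inj_on_subset) blast
    ultimately have "card {x \<in> verts (sunlet p). \<phi> x = y} = card ?Ay" by (simp add: card_image)
    also have "\<dots> = card (map_prod \<phi> \<phi> ` ?Ay)"
      by (rule card_image[symmetric], rule inj_on_subset[OF inj]) blast
    also have "map_prod \<phi> \<phi> ` ?Ay = {b \<in> map_prod \<phi> \<phi> ` ?A. fst b = y}"
      by (simp add: Compr_image_eq)
    also have "\<dots> = {b \<in> ?B. fst b = y}" using bij by (simp add: bij_betw_def)
    also have "card \<dots> = 2" by (rule standard_orientation_out[OF n y])
    finally show ?thesis .
  qed
  then have two: "two_to_one \<phi> (sunlet p) (torus n)" by (simp add: two_to_one_def)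
  have Z: "map_graph \<phi> (sunlet_cycle p) = map_graph h (cycle_graph p)"
    by (simp add: sunlet_cycle_def map_graph_def image_image \<phi>)
  have "is_cycle (map_graph h (cycle_graph p))"
    unfolding is_cycle_def using p bij_betw_imp_inj_on[OF h] by blast
  moreover have "edges (map_graph h (cycle_graph p)) \<subseteq> edges (torus n)"
    using step by (auto simp: map_cycle_graph_simps edge_torus_iff)
  moreover have "verts (map_graph h (cycle_graph p)) = verts (torus n)"
    using bij_betw_imp_surj_on[OF h] by (simp add: map_cycle_graph_simps)
  ultimately have ham: "hamiltonian_cycle (torus n) (map_graph \<phi> (sunlet_cycle p))"
    by (simp add: hamiltonian_cycle_def subgraph_def Z)
  have "compatible \<phi> ?A ?B" using arcs by (auto simp: compatible_def)
  then show ?thesis using that cov two ham by blast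
qed

text \<open>Indices are grouped in blocks of n. Inside a block the first coordinate advances;
  passing to the next block advances the second coordinate and keeps the first. The first coordinate
  is therefore i - i div n mod n, and the factor \<open>n - 1\<close> stands for -1 to avoid
  truncated subtraction.\<close>

definition torus_walk :: "nat \<Rightarrow> nat \<Rightarrow> nat \<times> nat" where
  "torus_walk n i = ((i + (n - 1) * (i div n)) mod n, i div n)"

lemma bij_betw_torus_walk:
  assumes "0 < n" shows "bij_betw (torus_walk n) {..<n^2} (verts (torus n))"
proof -
  \<comment> \<open>Adding the second coordinate to the first undoes the shift of the block and
    returns i mod n. A value of the walk thus reveals both quotient and remainder of its index;
    surjectivity then follows by counting.\<close>
  have rec: "(fst (torus_walk n i) + i div n) mod n = i mod n" for i
  proof -
    have "(fst (torus_walk n i) + i div n) mod n = (i + (n - 1) * (i div n) + i div n) mod n"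
      by (simp add: torus_walk_def mod_add_left_eq)
    also have "i + (n - 1) * (i div n) + i div n = i + n * (i div n)"
      using assms by (cases n) auto
    finally show ?thesis by simp
  qed
  have inj: "inj_on (torus_walk n) {..<n^2}"
  proof (rule inj_onI)
    fix i j assume eq: "torus_walk n i = torus_walk n j"
    then have "i div n = j div n" by (simp add: torus_walk_def)
    moreover from this have "i mod n = j mod n" using rec[of i] rec[of j] eq by simp
    ultimately show "i = j" by (metis div_mult_mod_eq)
  qed
  have "torus_walk n ` {..<n^2} \<subseteq> verts (torus n)"
    using assms by (auto simp: torus_walk_def verts_torus less_mult_imp_div_less power2_eq_square)
  moreover have "card (torus_walk n ` {..<n^2}) = card (verts (torus n))"
    unfolding card_image[OF inj] by (simp add: verts_torus power2_eq_square)
  moreover have "finite (verts (torus n))" by (simp add: verts_torus)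
  ultimately have "torus_walk n ` {..<n^2} = verts (torus n)" by (intro card_subset_eq)
  with inj show ?thesis by (simp add: bij_betw_def)
qed

lemma torus_walk_step:
  assumes i: "i < n^2"
  shows "(torus_walk n i, torus_walk n (Suc i mod n^2)) \<in> standard_orientation n"
proof -
  obtain m where n: "n = Suc m" using i by (cases n) auto
  have q: "i div n < n" using i by (simp add: less_mult_imp_div_less power2_eq_square)
  show ?thesis
  \<comment> \<open>The step stays inside a block exactly when \<open>Suc i\<close> is not a
    multiple of n; otherwise it enters the next block or closes the walk.\<close>
  proof (cases "Suc i mod n = 0")
    case False
    then have "Suc i \<noteq> n^2" by (auto simp: power2_eq_square)
    then have "Suc i mod n^2 = Suc i" using i by simp
    moreover have "Suc i div n = i div n" using False by (simp add: div_Suc)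
    ultimately show ?thesis
      using q n by (simp add: torus_walk_def standard_orientation_iff mod_Suc_eq)
  next
    case True
    then have d: "Suc i div n = Suc (i div n)" by (simp add: div_Suc)
    \<comment> \<open>Crossing a block boundary adds 1 from the index and m = n - 1 from the
      quotient, in total n, so the first coordinate is unchanged.\<close>
    have "Suc i + m * Suc (i div n) = i + m * (i div n) + n" using n by simp
    then have x: "(Suc i + m * Suc (i div n)) mod n = (i + m * (i div n)) mod n"
      by (simp only: mod_add_self2)
    show ?thesis
    proof (cases "Suc i = n^2")
      case False
      then have "Suc i < n^2" using i by simp
      then have "Suc (i div n) < n" using d
        by (metis less_mult_imp_div_less power2_eq_square)
      then show ?thesis using d x n \<open>Suc i < n^2\<close>
        by (simp add: torus_walk_def standard_orientation_iff del: mult_Suc_right)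
    next
      case wrap: True
      then have s: "Suc (i div n) = n" using d by (simp add: power2_eq_square)
      \<comment> \<open>The walk closes up because its formula continued to index n^2 has first
        coordinate 0 mod n. By \<open>x\<close> the last vertex is (0, n - 1), and one step in the
        second coordinate leads back to the start (0, 0).\<close>
      have "(i + m * (i div n)) mod n = (n * n + m * n) mod n" using x s wrap
        by (simp only: power2_eq_square)
      then have "(i + m * (i div n)) mod n = 0" by simp
      then show ?thesis using wrap s n q
        by (simp add: torus_walk_def standard_orientation_iff)
    qed
  qed
qed

theorem theorem1:
  fixes n :: nat
  assumes "n \<ge> 3"
  shows "\<exists>\<phi> :: sunlet_vertex \<Rightarrow> nat \<times> nat.
           homomorphism \<phi> (sunlet (n^2)) (torus n) \<and>
           covering \<phi> (sunlet (n^2)) (torus n) \<and>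
           two_to_one \<phi> (sunlet (n^2)) (torus n) \<and>
           hamiltonian_cycle (torus n) (map_graph \<phi> (sunlet_cycle (n^2))) \<and>
           compatible \<phi> (FSM_orientation (n^2)) (standard_orientation n)"
proof -
  have "n * 1 \<le> n * n" using assms by (intro mult_le_mono) auto
  then have "3 \<le> n^2" using assms by (simp only: power2_eq_square)
  moreover have "0 < n" using assms by simp
  ultimately obtain \<phi> where "covering \<phi> (sunlet (n^2)) (torus n)"
      "two_to_one \<phi> (sunlet (n^2)) (torus n)"
      "hamiltonian_cycle (torus n) (map_graph \<phi> (sunlet_cycle (n^2)))"
      "compatible \<phi> (FSM_orientation (n^2)) (standard_orientation n)"
    using sunlet_cover_if_directed_hamiltonian_cycle[OF assms _ bij_betw_torus_walk torus_walk_step]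
    by blast
  moreover from this(1) have "homomorphism \<phi> (sunlet (n^2)) (torus n)"
    by (simp add: covering_def)
  ultimately show ?thesis by blast
qed

end
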